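(* Let $r\ge 0$ and $n\ge 0$ be integers. Then the $r$-Bell number $B_{n,r}$ can be expressed in terms of the $r$-Lah numbers $\left\lfloor {n\atop k}\right\rfloor_r$ and the $r$-Stirling numbers of the second kind $\left\{ {n\atop k}\right\}_r$ by $$B_{n,r} = \sum_{k=0}^{n} (-1)^{n-k}\left\{ {n\atop k}\right\}_{r}\sum_{j=0}^{k} \left\lfloor {k\atop j}\right\rfloor_r .$$
   Context: For integers $r\ge 0$ and $0\le k\le n$: - $\left\{ {n\atop k}\right\}_r$ (the $r$-Stirling number of the second kind) is the number of partitions of a set with $n+r$ elements into $k+r$ nonempty subsets such that $r$ distinguished elements lie in distinct subsets; it satisfies $\left\{ {n+1\atop k}\right\}_{r}=\left\{ {n\atop k-1}\right\}_{r}+(k+r)\left\{ {n\atop k}\right\}_{r}$ with $\left\{ {0\atop 0}\right\}_r=1$. - $\left\lfloor {n\atop k}\right\rfloor_r$ (the $r$-Lah number) is the number of partitions of a set with $n+r$ elements into $k+r$ nonempty linearly ordered subsets such that $r$ distinguished elements lie in distinct ordered subsets; it satisfies $\left\lfloor {n+1\atop k}\right\rfloor_r= \left\lfloor {n\atop k-1}\right\rfloor_r+(n+k+2r) \left\lfloor {n\atop k}\right\rfloor_r$ with $\left\lfloor {0\atop 0}\right\rfloor_r=1$. Both kinds of numbers are $0$ when $k<0$ or $k>n$. The $r$-Bell numbers are $B_{n,r}=\sum_{k=0}^{n}\left\{ {n\atop k}\right\}_r$. *)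

theory Defs
  imports Main "HOL-Library.Disjoint_Sets"
begin

text \<open>
  The ground set of size \<open>n + r\<close> is \<open>{..<n + r}\<close>, with distinguished elements \<open>{..<r}\<close>.
\<close>

definition separates :: "nat \<Rightarrow> nat set set \<Rightarrow> bool" where
  "separates r P \<longleftrightarrow> (\<forall>B\<in>P. \<forall>i\<in>B. \<forall>j\<in>B. i < r \<longrightarrow> j < r \<longrightarrow> i = j)"

definition r_stirling2 :: "nat \<Rightarrow> nat \<Rightarrow> nat \<Rightarrow> nat" where
  "r_stirling2 r n k =
     card {P. partition_on {..<n + r} P \<and> card P = k + r \<and> separates r P}"

text \<open>
  A linearly ordered block is a list without repetitions. Injectivity of \<^const>\<open>set\<close> on \<open>L\<close>
  excludes that one block occurs in \<open>L\<close> with two different orders.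
\<close>

definition ordered_partition_on :: "'a set \<Rightarrow> 'a list set \<Rightarrow> bool" where
  "ordered_partition_on A L \<longleftrightarrow>
     (\<forall>xs\<in>L. distinct xs) \<and> inj_on set L \<and> partition_on A (set ` L)"

definition r_lah :: "nat \<Rightarrow> nat \<Rightarrow> nat \<Rightarrow> nat" where
  "r_lah r n k =
     card {L. ordered_partition_on {..<n + r} L \<and> card L = k + r \<and> separates r (set ` L)}"

definition r_bell :: "nat \<Rightarrow> nat \<Rightarrow> nat" where
  "r_bell r n = (\<Sum>k=0..n. r_stirling2 r n k)"

end

theory Submission
  imports Defs "HOL-Combinatorics.Multiset_Permutations"
begin

text \<open>
  Deleting the largest element of the ground set yields recurrences for both families of numbers, the
  \<open>r\<close>-Lah numbers being obtained by weighting each partition with the product of the factorials of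
  its block sizes. By these recurrences, \<open>T n j = (\<Sum>k\<le>n. (-1)^(n-k) S(n,k) L(k,j))\<close> satisfies the
  recurrence of \<open>S(n,j)\<close>: the term \<open>(k + r) S(n,k)\<close> in the recurrence of \<open>S\<close> lowers the factor
  \<open>k + j + 2r\<close> in the recurrence of \<open>L\<close> to \<open>j + r\<close>. Summing \<open>T n j = S(n,j)\<close> over \<open>j\<close> gives the result.
\<close>

section \<open>Adjoining and deleting one element of a set partition\<close>

lemma partition_on_extend:
  assumes "a \<notin> A" "partition_on A Q" "B \<in> insert {} Q"
  shows "partition_on (insert a A) (insert (insert a B) (Q - {B}))"
proof (rule partition_onI)
  have Q: "\<Union>Q = A" "{} \<notin> Q" using assms(2) by (auto simp: partition_on_def)
  have dj: "X \<inter> Y = {}" if "X \<in> Q" "Y \<in> insert {} Q" "X \<noteq> Y" for X Y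
    using that assms(2) by (auto simp: partition_on_def disjoint_def)
  have nin: "a \<notin> X" if "X \<in> Q" for X using that Q assms(1) by auto
  show "\<Union>(insert (insert a B) (Q - {B})) = insert a A"
    using Q assms(3) by auto
  show "{} \<notin> insert (insert a B) (Q - {B})"
    using Q by auto
  show "disjnt X Y" if "X \<in> insert (insert a B) (Q - {B})" "Y \<in> insert (insert a B) (Q - {B})" "X \<noteq> Y" for X Y
    using that dj nin assms(3) unfolding disjnt_def by blast
qed

text \<open>Subtracting \<open>{{}}\<close> drops the remainder of \<open>C\<close> when
  \<open>C = {a}\<close>, so that no empty block arises.\<close>

lemma partition_on_shrink:
  assumes "a \<notin> A" "partition_on (insert a A) P" "C \<in> P" "a \<in> C"
  shows "partition_on A ((P - {C}) \<union> ({C - {a}} - {{}}))"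
proof (rule partition_onI)
  have P: "\<Union>P = insert a A" "{} \<notin> P" using assms(2) by (auto simp: partition_on_def)
  have dj: "X \<inter> Y = {}" if "X \<in> P" "Y \<in> P" "X \<noteq> Y" for X Y
    using that assms(2) by (auto simp: partition_on_def disjoint_def)
  have nin: "a \<notin> X" if "X \<in> P" "X \<noteq> C" for X using that dj assms(3,4) by blast
  show "\<Union>((P - {C}) \<union> ({C - {a}} - {{}})) = A"
  proof -
    have "\<Union>((P - {C}) \<union> ({C - {a}} - {{}})) = \<Union>P - {a}"
      using nin assms(3,4) by auto
    then show ?thesis using P assms(1) by auto
  qed
  show "{} \<notin> (P - {C}) \<union> ({C - {a}} - {{}})"
    using P by auto
  show "disjnt X Y" if "X \<in> (P - {C}) \<union> ({C - {a}} - {{}})" "Y \<in> (P - {C}) \<union> ({C - {a}} - {{}})" "X \<noteq> Y" for X Y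
    using that dj assms(3) unfolding disjnt_def by blast
qed

text \<open>The empty set serves as the label of the extension in which \<open>a\<close> forms a block of its own.\<close>

lemma bij_betw_partition_on_insert:
  assumes "a \<notin> A"
  shows "bij_betw (\<lambda>(Q, B). insert (insert a B) (Q - {B}))
    (SIGMA Q:{Q. partition_on A Q}. insert {} Q) {P. partition_on (insert a A) P}"
proof (rule bij_betw_byWitness)
  \<comment> \<open>\<open>?C P\<close> is the block containing \<open>a\<close>. The inverse
    \<open>?g\<close> deletes \<open>a\<close> from it and records the remainder as the label; the
    label is empty exactly when \<open>a\<close> formed a block alone.\<close>
  let ?C = "\<lambda>P. THE C. C \<in> P \<and> a \<in> C"
  let ?f = "\<lambda>(Q, B). insert (insert a B) (Q - {B})"
  let ?g = "\<lambda>P. ((P - {?C P}) \<union> ({?C P - {a}} - {{}}), ?C P - {a})"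
  show "\<forall>z\<in>(SIGMA Q:{Q. partition_on A Q}. insert {} Q). ?g (?f z) = z"
  proof (intro ballI)
    fix z assume "z \<in> (SIGMA Q:{Q. partition_on A Q}. insert {} Q)"
    then obtain Q B where z: "z = (Q, B)" and Q: "partition_on A Q" "B \<in> insert {} Q"
      by auto
    have nin: "a \<notin> X" "X \<noteq> {}" if "X \<in> Q" for X
      using that Q assms by (auto simp: partition_on_def)
    have C: "?C (insert (insert a B) (Q - {B})) = insert a B"
      using nin by (intro the_equality) auto
    \<comment> \<open>Since the enlarged block is new, removing it leaves exactly
      \<open>Q - {B}\<close>.\<close>
    have "a \<notin> B" "insert a B \<notin> Q" using nin Q(2) by auto
    then show "?g (?f z) = z"
      unfolding z prod.case C using Q(2) nin by auto
  qed
  have C: "?C P \<in> P" "a \<in> ?C P" if "partition_on (insert a A) P" for P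
  proof -
    have "\<exists>!C. C \<in> P \<and> a \<in> C"
      using that unfolding partition_on_def disjoint_def by blast
    from theI'[OF this] show "?C P \<in> P" "a \<in> ?C P" by auto
  qed
  show "\<forall>P\<in>{P. partition_on (insert a A) P}. ?f (?g P) = P"
  proof (intro ballI)
    fix P assume "P \<in> {P. partition_on (insert a A) P}"
    then have P: "partition_on (insert a A) P" by simp
    have "{} \<notin> P" using P by (auto simp: partition_on_def)
    \<comment> \<open>Otherwise \<open>?f\<close> would remove an original block of \<open>P\<close>
      along with the label. Such a block would be disjoint from \<open>?C P\<close> and contained in
      it, hence empty.\<close>
    moreover have "?C P - {a} \<notin> P"
    proof
      assume D: "?C P - {a} \<in> P"
      have "?C P - {a} \<noteq> ?C P" using C(2)[OF P] by blast
      then have "(?C P - {a}) \<inter> ?C P = {}"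
        using disjointD[OF partition_onD2[OF P] D C(1)[OF P]] by simp
      then have "?C P - {a} = {}" by blast
      then show False using D \<open>{} \<notin> P\<close> by metis
    qed
    moreover have "insert a (?C P - {a}) = ?C P" using C(2)[OF P] by blast
    ultimately show "?f (?g P) = P" using C(1)[OF P] by auto
  qed
  show "?f ` (SIGMA Q:{Q. partition_on A Q}. insert {} Q) \<subseteq> {P. partition_on (insert a A) P}"
    using partition_on_extend[OF assms] by auto
  show "?g ` {P. partition_on (insert a A) P} \<subseteq> (SIGMA Q:{Q. partition_on A Q}. insert {} Q)"
    using partition_on_shrink[OF assms _ C] by auto
qed

text \<open>The summand is arbitrary, so conditions on the partition can later be encoded by letting
  \<open>g\<close> vanish where they fail.\<close>

lemma sum_partition_on_insert:
  fixes g :: "'a set set \<Rightarrow> 'b::comm_monoid_add"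
  assumes "finite A" "a \<notin> A"
  shows "(\<Sum>P | partition_on (insert a A) P. g P) =
    (\<Sum>Q | partition_on A Q. g (insert {a} Q) + (\<Sum>B\<in>Q. g (insert (insert a B) (Q - {B}))))"
proof -
  have fin: "finite {Q. partition_on A Q}" "\<And>Q. partition_on A Q \<Longrightarrow> finite Q"
    using assms(1) by (auto intro: finitely_many_partition_on finite_elements)
  have "(\<Sum>P | partition_on (insert a A) P. g P) =
      (\<Sum>(Q, B)\<in>(SIGMA Q:{Q. partition_on A Q}. insert {} Q). g (insert (insert a B) (Q - {B})))"
    by (subst sum.reindex_bij_betw[OF bij_betw_partition_on_insert[OF assms(2)], symmetric])
       (simp add: case_prod_beta)
  also have "\<dots> = (\<Sum>Q | partition_on A Q. \<Sum>B\<in>insert {} Q. g (insert (insert a B) (Q - {B})))"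
    using fin by (subst sum.Sigma) auto
  also have "\<dots> = (\<Sum>Q | partition_on A Q. g (insert {a} Q) + (\<Sum>B\<in>Q. g (insert (insert a B) (Q - {B}))))"
  proof (rule sum.cong[OF refl])
    fix Q assume "Q \<in> {Q. partition_on A Q}"
    then have "finite Q" "{} \<notin> Q" using fin by (auto simp: partition_on_def)
    then show "(\<Sum>B\<in>insert {} Q. g (insert (insert a B) (Q - {B}))) =
        g (insert {a} Q) + (\<Sum>B\<in>Q. g (insert (insert a B) (Q - {B})))"
      by simp
  qed
  finally show ?thesis .
qed

section \<open>Weighted counts of separated partitions and their recurrence\<close>

definition r_partitions :: "nat \<Rightarrow> nat \<Rightarrow> nat \<Rightarrow> nat set set set" where
  "r_partitions r n k = {P. partition_on {..<n + r} P \<and> card P = k + r \<and> separates r P}"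

text \<open>A single recurrence proof then covers both families: constant weight 1 gives the
  Stirling numbers, factorials give the Lah numbers.\<close>

definition weighted_count :: "(nat \<Rightarrow> nat) \<Rightarrow> nat \<Rightarrow> nat \<Rightarrow> nat \<Rightarrow> nat" where
  "weighted_count w r n k = (\<Sum>P\<in>r_partitions r n k. \<Prod>B\<in>P. w (card B))"

text \<open>Choosing for each distinguished element a block containing it is injective by
  separation.\<close>

lemma separates_card_ge:
  assumes "partition_on {..<n + r} P" "separates r P"
  shows "r \<le> card P"
proof -
  have "\<exists>B. B \<in> P \<and> i \<in> B" if "i < r" for i
  proof -
    have "i \<in> \<Union>P" using assms(1) that by (auto simp: partition_on_def)
    then show ?thesis by auto
  qed
  then obtain f where f: "f i \<in> P" "i \<in> f i" if "i < r" for i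
    by metis
  have "inj_on f {..<r}"
  proof (rule inj_onI)
    fix i j assume "i \<in> {..<r}" "j \<in> {..<r}" "f i = f j"
    then show "i = j" using f[of i] f[of j] assms(2) unfolding separates_def by auto
  qed
  moreover have "f ` {..<r} \<subseteq> P" using f by auto
  moreover have "finite P" using assms(1) by (rule finite_elements[rotated]) simp
  ultimately show ?thesis
    using card_inj_on_le[of f "{..<r}" P] by simp
qed

lemma r_partitions_0: "r_partitions r 0 k = (if k = 0 then {(\<lambda>i. {i}) ` {..<r}} else {})"
proof -
  let ?S = "(\<lambda>i. {i}) ` {..<r}"
  have eq: "P = ?S" if P: "partition_on {..<r} P" "separates r P" for P
  proof -
    \<comment> \<open>For \<open>n = 0\<close> every element is distinguished, so no block has two
      elements.\<close>
    have sing: "B = {i}" if "B \<in> P" "i \<in> B" for B i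
    proof -
      have "B \<subseteq> {..<r}" using P(1) that by (auto simp: partition_on_def)
      then show ?thesis using that P(2) unfolding separates_def lessThan_def by fast
    qed
    show ?thesis
    proof (intro equalityI subsetI)
      fix B assume B: "B \<in> P"
      then obtain i where i: "i \<in> B" using partition_onD3[OF P(1)] by fastforce
      then have "i < r" using partition_onD1[OF P(1)] B by blast
      then show "B \<in> ?S" using sing[OF B i] by simp
    next
      fix B assume "B \<in> ?S"
      then obtain i where i: "i < r" "B = {i}" by auto
      then obtain C where "C \<in> P" "i \<in> C" using partition_onD1[OF P(1)] by blast
      then show "B \<in> P" using sing i by metis
    qed
  qed
  have "partition_on {..<r} ?S" by (rule partition_on_singletons)
  moreover have "separates r ?S" by (simp add: separates_def)
  moreover have "card ?S = r" by (simp add: card_image)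
  ultimately have "P \<in> r_partitions r 0 k \<longleftrightarrow> P = ?S \<and> k = 0" for P
    using eq[of P] unfolding r_partitions_def mem_Collect_eq add_0
    by (metis add_eq_self_zero add.commute add_0)
  then show ?thesis by auto
qed

lemma weighted_count_0:
  assumes "w 1 = 1"
  shows "weighted_count w r 0 k = (if k = 0 then 1 else 0)"
  using assms by (simp add: weighted_count_def r_partitions_0 prod.reindex)

text \<open>The new element \<open>n + r\<close> is not distinguished, so it may go anywhere. As a
  singleton it contributes the factor \<open>w 1 = 1\<close>; put into \<open>B\<close> it
  multiplies the weight by \<open>c (card B)\<close>, and these factors add up to \<open>d\<close>
  over all blocks.\<close>

lemma weighted_count_Suc:
  assumes w1: "w 1 = 1" and wS: "\<And>b. 0 < b \<Longrightarrow> w (Suc b) = c b * w b"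
    and cQ: "\<And>Q. Q \<in> r_partitions r n k \<Longrightarrow> (\<Sum>B\<in>Q. c (card B)) = d"
  shows "weighted_count w r (Suc n) k =
    (case k of 0 \<Rightarrow> 0 | Suc k' \<Rightarrow> weighted_count w r n k') + d * weighted_count w r n k"
proof -
  define \<pi> where "\<pi> P = (\<Prod>B\<in>P. w (card B))" for P :: "nat set set"
  define g where "g P = (if card P = k + r \<and> separates r P then \<pi> P else 0)" for P
  \<comment> \<open>\<open>h\<close> is the contribution of a new singleton block. Writing
    \<open>Suc (card Q)\<close> on the left avoids subtraction when
    \<open>k + r = 0\<close>.\<close>
  define h where "h Q = (if Suc (card Q) = k + r \<and> separates r Q then \<pi> Q else 0)" for Q
  let ?m = "n + r"
  let ?X = "{Q. partition_on {..<?m} Q}"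
  have restrict: "(\<Sum>P | partition_on A P. if p P then f P else 0) =
      (\<Sum>P | partition_on A P \<and> p P. f P)" if "finite A" for A :: "nat set" and p and f :: "_ \<Rightarrow> nat"
    using that by (subst sum.inter_filter[symmetric])
      (auto intro: finitely_many_partition_on)
  have "weighted_count w r (Suc n) k = (\<Sum>P | partition_on (insert ?m {..<?m}) P. g P)"
    unfolding g_def by (subst restrict)
      (simp_all add: weighted_count_def r_partitions_def \<pi>_def lessThan_Suc)
  also have "\<dots> = (\<Sum>Q\<in>?X. g (insert {?m} Q) + (\<Sum>B\<in>Q. g (insert (insert ?m B) (Q - {B}))))"
    by (rule sum_partition_on_insert) auto
  also have "\<dots> = (\<Sum>Q\<in>?X. h Q + d * g Q)"
  proof (rule sum.cong[OF refl])
    fix Q assume "Q \<in> ?X"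
    then have Q: "partition_on {..<?m} Q" by simp
    have finQ: "finite Q" using Q by (rule finite_elements[rotated]) simp
    have un: "\<Union>Q = {..<?m}" using Q by (auto simp: partition_on_def)
    have blk: "?m \<notin> B" "finite B" "B \<noteq> {}" if "B \<in> Q" for B
    proof -
      have "B \<subseteq> {..<?m}" using un that by blast
      then show "?m \<notin> B" "finite B" by (auto intro: finite_subset)
      show "B \<noteq> {}" using Q that by (auto simp: partition_on_def)
    qed
    have fresh: "insert ?m B \<notin> Q" for B using blk by blast
    have "separates r (insert {?m} Q) \<longleftrightarrow> separates r Q"
      by (simp add: separates_def)
    then have 1: "g (insert {?m} Q) = h Q"
      using finQ fresh[of "{}"] w1 by (simp add: g_def h_def \<pi>_def)
    have 2: "g (insert (insert ?m B) (Q - {B})) = c (card B) * g Q" if B: "B \<in> Q" for B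
    proof -
      \<comment> \<open>Writing \<open>Q\<close> as \<open>insert B (Q - {B})\<close> lets the two
        families be compared block by block; \<open>?m\<close> is at least \<open>r\<close> and adds
        no constraint.\<close>
      have "separates r (insert (insert ?m B) (Q - {B})) \<longleftrightarrow> separates r (insert B (Q - {B}))"
        by (simp add: separates_def del: insert_Diff_single)
      then have "separates r (insert (insert ?m B) (Q - {B})) \<longleftrightarrow> separates r Q"
        using B by (simp only: insert_Diff)
      moreover have "card (insert (insert ?m B) (Q - {B})) = card Q"
        using finQ fresh B card_Suc_Diff1[OF finQ B] by simp
      moreover have "\<pi> (insert (insert ?m B) (Q - {B})) = c (card B) * \<pi> Q"
      proof -
        have "0 < card B" using blk[OF B] by (simp add: card_gt_0_iff)
        then show ?thesis
          using finQ fresh B blk[OF B] wS[of "card B"]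
          by (simp add: \<pi>_def prod.remove[OF finQ B])
      qed
      ultimately show ?thesis by (simp add: g_def)
    qed
    have "(\<Sum>B\<in>Q. g (insert (insert ?m B) (Q - {B}))) = (\<Sum>B\<in>Q. c (card B)) * g Q"
      using 2 by (simp add: sum_distrib_right)
    \<comment> \<open>If \<open>Q\<close> fails the conditions in \<open>g\<close>, both sides
      vanish; otherwise \<open>Q\<close> lies in \<open>r_partitions r n k\<close> and
      \<open>cQ\<close> applies.\<close>
    also have "\<dots> = d * g Q"
      using cQ[of Q] Q by (auto simp: g_def r_partitions_def)
    finally show "g (insert {?m} Q) + (\<Sum>B\<in>Q. g (insert (insert ?m B) (Q - {B}))) = h Q + d * g Q"
      using 1 by simp
  qed
  also have "\<dots> = (\<Sum>Q\<in>?X. h Q) + d * (\<Sum>Q\<in>?X. g Q)"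
    by (simp add: sum.distrib sum_distrib_left)
  also have "(\<Sum>Q\<in>?X. g Q) = weighted_count w r n k"
    unfolding g_def by (subst restrict) (simp_all add: weighted_count_def r_partitions_def \<pi>_def)
  also have "(\<Sum>Q\<in>?X. h Q) = (case k of 0 \<Rightarrow> 0 | Suc k' \<Rightarrow> weighted_count w r n k')"
  proof (cases k)
    case 0
    \<comment> \<open>A nonzero \<open>h Q\<close> would need fewer than \<open>r\<close> blocks,
      contradicting \<open>separates_card_ge\<close>.\<close>
    then show ?thesis
      using separates_card_ge by (fastforce simp: h_def intro!: sum.neutral)
  next
    case (Suc k')
    then show ?thesis
      unfolding h_def by (subst restrict)
        (simp_all add: weighted_count_def r_partitions_def \<pi>_def)
  qed
  finally show ?thesis .
qed

section \<open>Both families as weighted counts\<close>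

lemma r_stirling2_eq_weighted: "r_stirling2 r n k = weighted_count (\<lambda>_. 1) r n k"
  by (simp add: r_stirling2_def weighted_count_def r_partitions_def)

text \<open>Ordering the blocks of \<open>P\<close> amounts to choosing a permutation of each block
  independently. The choice function is recovered from its image because \<open>set\<close> maps
  each list back to its block.\<close>

lemma card_ordered_partitions_over:
  assumes P: "partition_on A P" and A: "finite A"
  shows "card {L. ordered_partition_on A L \<and> set ` L = P} = (\<Prod>B\<in>P. fact (card B))"
proof -
  have finP: "finite P" "\<And>B. B \<in> P \<Longrightarrow> finite B"
    using P A by (auto intro: finite_elements simp: partition_on_def dest: finite_subset[OF Sup_upper])
  have "bij_betw (\<lambda>f. f ` P) (Pi\<^sub>E P permutations_of_set) {L. ordered_partition_on A L \<and> set ` L = P}"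
  proof (rule bij_betwI')
    fix f g assume f: "f \<in> Pi\<^sub>E P permutations_of_set" and g: "g \<in> Pi\<^sub>E P permutations_of_set"
    have set_f: "set (f B) = B" and set_g: "set (g B) = B" if "B \<in> P" for B
      using that f g by (auto simp: permutations_of_set_def dest: PiE_mem)
    show "(f ` P = g ` P) = (f = g)"
    proof
      assume eq: "f ` P = g ` P"
      show "f = g"
      proof (rule PiE_ext[OF f g])
        fix B assume B: "B \<in> P"
        then obtain C where C: "C \<in> P" "f B = g C" using eq by blast
        then have "B = C" using set_f[OF B] set_g[OF C(1)] by simp
        then show "f B = g B" using C by simp
      qed
    qed simp
  next
    fix f assume f: "f \<in> Pi\<^sub>E P permutations_of_set"
    have set_f: "set (f B) = B" "distinct (f B)" if "B \<in> P" for B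
      using that f by (auto simp: permutations_of_set_def dest: PiE_mem)
    have "set ` f ` P = P" using set_f(1) by (simp add: image_image)
    moreover have "inj_on set (f ` P)" using set_f(1) by (auto simp: inj_on_def)
    ultimately show "f ` P \<in> {L. ordered_partition_on A L \<and> set ` L = P}"
      using set_f P by (auto simp: ordered_partition_on_def)
  next
    fix L assume "L \<in> {L. ordered_partition_on A L \<and> set ` L = P}"
    then have L: "\<And>xs. xs \<in> L \<Longrightarrow> distinct xs" "inj_on set L" "set ` L = P"
      by (auto simp: ordered_partition_on_def)
    let ?f = "restrict (inv_into L set) P"
    have "?f \<in> Pi\<^sub>E P permutations_of_set"
      using L by (auto simp: permutations_of_set_def)
    moreover have "L = ?f ` P"
      using L by (auto simp: image_image)
    ultimately show "\<exists>f\<in>Pi\<^sub>E P permutations_of_set. L = f ` P" by blast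
  qed
  then have "card {L. ordered_partition_on A L \<and> set ` L = P} = card (Pi\<^sub>E P permutations_of_set)"
    by (rule bij_betw_same_card[symmetric])
  also have "\<dots> = (\<Prod>B\<in>P. fact (card B))"
    using finP by (simp add: card_PiE)
  finally show ?thesis .
qed

lemma r_lah_eq_weighted: "r_lah r n k = weighted_count fact r n k"
proof -
  let ?A = "{..<n + r}"
  let ?F = "\<lambda>P. {L. ordered_partition_on ?A L \<and> set ` L = P}"
  have part: "partition_on ?A P" if "P \<in> r_partitions r n k" for P
    using that by (simp add: r_partitions_def)
  have fin: "finite (r_partitions r n k)"
    by (rule finite_subset[OF _ finitely_many_partition_on[of ?A]]) (auto dest: part)
  have "card L = card (set ` L)" if "ordered_partition_on ?A L" for L
    using that by (simp add: ordered_partition_on_def card_image)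
  then have "{L. ordered_partition_on ?A L \<and> card L = k + r \<and> separates r (set ` L)} =
      (\<Union>P\<in>r_partitions r n k. ?F P)"
    by (auto simp: r_partitions_def ordered_partition_on_def)
  moreover have "finite (?F P)" if "P \<in> r_partitions r n k" for P
  proof -
    \<comment> \<open>Infinite sets have \<open>card\<close> 0, so a positive cardinality proves the
      fibre finite.\<close>
    have "0 < (\<Prod>B\<in>P. fact (card B) :: nat)" by (rule prod_pos) simp
    then show ?thesis
      using card_ordered_partitions_over[OF part[OF that]] by (metis card_gt_0_iff finite_lessThan)
  qed
  ultimately have "r_lah r n k = (\<Sum>P\<in>r_partitions r n k. card (?F P))"
    unfolding r_lah_def using fin by (subst card_UN_disjoint[symmetric]) auto
  then show ?thesis
    by (simp add: weighted_count_def card_ordered_partitions_over[OF part])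
qed

section \<open>Initial values, recurrences and vanishing above the diagonal\<close>

lemma r_stirling2_0: "r_stirling2 r 0 k = (if k = 0 then 1 else 0)"
  by (simp add: r_stirling2_eq_weighted weighted_count_0)

lemma r_lah_0: "r_lah r 0 k = (if k = 0 then 1 else 0)"
  by (simp add: r_lah_eq_weighted weighted_count_0)

lemma r_stirling2_Suc:
  "r_stirling2 r (Suc n) k =
    (case k of 0 \<Rightarrow> 0 | Suc k' \<Rightarrow> r_stirling2 r n k') + (k + r) * r_stirling2 r n k"
  unfolding r_stirling2_eq_weighted
  by (rule weighted_count_Suc[where c = "\<lambda>_. 1"]) (auto simp: r_partitions_def)

text \<open>A block of size b has b + 1 places for the new element. Block sizes sum to
  \<open>n + r\<close> and there are \<open>k + r\<close> blocks, which gives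
  \<open>n + k + 2 * r\<close> places in all.\<close>

lemma r_lah_Suc:
  "r_lah r (Suc n) k =
    (case k of 0 \<Rightarrow> 0 | Suc k' \<Rightarrow> r_lah r n k') + (n + k + 2 * r) * r_lah r n k"
  unfolding r_lah_eq_weighted
proof (rule weighted_count_Suc[where c = Suc])
  fix Q assume "Q \<in> r_partitions r n k"
  then have Q: "partition_on {..<n + r} Q" "card Q = k + r" by (auto simp: r_partitions_def)
  have "finite B" if "B \<in> Q" for B
    using that partition_onD1[OF Q(1)] by (metis Sup_upper finite_lessThan finite_subset)
  then have "(\<Sum>B\<in>Q. card B) = n + r"
    using product_partition[OF Q(1)] by simp
  then show "(\<Sum>B\<in>Q. Suc (card B)) = n + k + 2 * r"
    using Q(2) by (simp add: sum_Suc)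
qed auto

lemma r_stirling2_eq_0: "n < k \<Longrightarrow> r_stirling2 r n k = 0"
  by (induction n arbitrary: k) (auto simp: r_stirling2_0 r_stirling2_Suc split: nat.split)

lemma r_lah_eq_0: "n < k \<Longrightarrow> r_lah r n k = 0"
  by (induction n arbitrary: k) (auto simp: r_lah_0 r_lah_Suc split: nat.split)

section \<open>The inversion formula and its sum over columns\<close>

text \<open>The exponent \<open>n + k\<close> has the parity of \<open>n - k\<close> for k \<le> n
  and avoids truncated subtraction. The induction keeps \<open>j\<close> arbitrary because the
  recurrence also involves column \<open>j - 1\<close>.\<close>

lemma r_stirling2_r_lah_inversion:
  "(\<Sum>k\<le>n. (- 1) ^ (n + k) * int (r_stirling2 r n k) * int (r_lah r k j)) = int (r_stirling2 r n j)"
proof (induction n arbitrary: j)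
  case 0
  then show ?case by (simp add: r_stirling2_0 r_lah_0)
next
  case (Suc n)
  define S where "S k = (- 1) ^ (n + k) * int (r_stirling2 r n k)" for k
  define l where "l k = int (r_lah r k j)" for k
  \<comment> \<open>\<open>p\<close> is the column to the left of \<open>l\<close>; its value 0 at
    \<open>j = 0\<close> stands for the column of index -1.\<close>
  define p where "p k = (case j of 0 \<Rightarrow> 0 | Suc j' \<Rightarrow> int (r_lah r k j'))" for k
  have top: "S (Suc n) = 0" by (simp add: S_def r_stirling2_eq_0)
  have "(\<Sum>k\<le>Suc n. (- 1) ^ (Suc n + k) * int (r_stirling2 r (Suc n) k) * int (r_lah r k j)) =
      - (int r * S 0 * l 0) + (\<Sum>k\<le>n. S k * l (Suc k) - (int (Suc k) + r) * S (Suc k) * l (Suc k))"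
    unfolding sum.atMost_Suc_shift
    by (simp add: S_def l_def r_stirling2_Suc algebra_simps sum_subtractf)
  \<comment> \<open>The separate term in \<open>S 0\<close> is the \<open>k = 0\<close> term missing
    from the shifted sum; \<open>top\<close> then removes the term at \<open>Suc n\<close>.\<close>
  also have "\<dots> = (\<Sum>k\<le>n. S k * l (Suc k)) - (\<Sum>k\<le>Suc n. (int k + r) * S k * l k)"
    unfolding sum.atMost_Suc_shift by (simp add: sum_subtractf)
  also have "\<dots> = (\<Sum>k\<le>n. S k * (l (Suc k) - (int k + r) * l k))"
    by (simp add: top sum_subtractf algebra_simps)
  \<comment> \<open>By the Lah recurrence, \<open>l (Suc k)\<close> is \<open>p k\<close> plus k + j
    + 2r times \<open>l k\<close>; subtracting k + r times \<open>l k\<close> leaves a factor j + r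
    independent of \<open>k\<close>.\<close>
  also have "\<dots> = (\<Sum>k\<le>n. S k * p k + (int j + r) * (S k * l k))"
    by (intro sum.cong refl)
      (auto simp: l_def p_def r_lah_Suc algebra_simps split: nat.split)
  also have "\<dots> = (\<Sum>k\<le>n. S k * p k) + (int j + r) * int (r_stirling2 r n j)"
    using Suc.IH[of j] by (simp add: sum.distrib sum_distrib_left[symmetric] S_def l_def)
  also have "\<dots> = int (r_stirling2 r (Suc n) j)"
    using Suc.IH[of "j - 1"] by (cases j) (simp_all add: S_def p_def r_stirling2_Suc algebra_simps)
  finally show ?case .
qed

theorem theorem4p1:
  fixes r n :: nat
  shows "int (r_bell r n) =
    (\<Sum>k=0..n. (- 1) ^ (n - k) * int (r_stirling2 r n k) * (\<Sum>j=0..k. int (r_lah r k j)))"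
proof -
  have "int (r_bell r n) = (\<Sum>j\<le>n. int (r_stirling2 r n j))"
    by (simp add: r_bell_def atLeast0AtMost)
  also have "\<dots> = (\<Sum>j\<le>n. \<Sum>k\<le>n. (- 1) ^ (n + k) * int (r_stirling2 r n k) * int (r_lah r k j))"
    by (simp add: r_stirling2_r_lah_inversion)
  also have "\<dots> = (\<Sum>k\<le>n. (- 1) ^ (n + k) * int (r_stirling2 r n k) * (\<Sum>j\<le>n. int (r_lah r k j)))"
    by (subst sum.swap) (simp add: sum_distrib_left)
  also have "\<dots> = (\<Sum>k\<le>n. (- 1) ^ (n - k) * int (r_stirling2 r n k) * (\<Sum>j\<le>k. int (r_lah r k j)))"
  proof (rule sum.cong[OF refl])
    fix k assume "k \<in> {..n}"
    then have k: "k \<le> n" by simp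
    \<comment> \<open>Exchanging the sums required a range of \<open>j\<close> independent of
      \<open>k\<close>; vanishing Lah numbers now let it be cut at \<open>k\<close>.\<close>
    have "(\<Sum>j\<le>n. int (r_lah r k j)) = (\<Sum>j\<le>k. int (r_lah r k j))"
      using k by (intro sum.mono_neutral_right) (auto simp: r_lah_eq_0)
    moreover have "(- 1 :: int) ^ (n + k) = (- 1) ^ (n - k)"
      using k by (simp add: minus_one_power_iff)
    ultimately show "(- 1) ^ (n + k) * int (r_stirling2 r n k) * (\<Sum>j\<le>n. int (r_lah r k j)) =
        (- 1) ^ (n - k) * int (r_stirling2 r n k) * (\<Sum>j\<le>k. int (r_lah r k j))"
      by simp
  qed
  finally show ?thesis by (simp add: atLeast0AtMost)
qed

end
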